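(* Let $p$ be a prime with $3\mid(p-1)$, $g$ a primitive root modulo $p$, $d=3$, $k=(p-1)/3$, $e_p(x)=e^{2\pi i x/p}$, and $\eta_a=\sum_{j=0}^{k-1}e_p(g^{3j+a})$. Let $V_4(p)=\sum_{s=0}^{2}|\eta_s|^4$. Let $M_{0,0,0}$ be the number of $\mathbb{F}_p$-rational points in $\mathbb{P}^2(\mathbb{F}_p)$ on the Fermat curve $x^3+y^3=z^3$ and put $t_0=(M_{0,0,0}-9)/9$. Then $$V_4(p)=\frac{1}{27}(10p^2-20p+1)-\frac{4}{3}pt_0.$$ Moreover, $\big|27V_4(p)-(6p^2+12p+1)\big|\le 8p^{3/2}$; that is, $$\frac{6p^2-8p^{3/2}+12p+1}{27}\le V_4(p)\le\frac{6p^2+8p^{3/2}+12p+1}{27}.$$ *)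

theory Defs
  imports Complex_Main "HOL-Number_Theory.Number_Theory"
begin

definition add_char :: "nat \<Rightarrow> int \<Rightarrow> complex" where
  "add_char p x = exp (2 * of_real pi * \<i> * of_int x / of_nat p)"

definition gauss_period :: "nat \<Rightarrow> nat \<Rightarrow> nat \<Rightarrow> nat \<Rightarrow> complex" where
  "gauss_period p d g a = (\<Sum>j<(p - 1) div d. add_char p (int (g ^ (d * j + a))))"

definition V4 :: "nat \<Rightarrow> nat \<Rightarrow> nat \<Rightarrow> real" where
  "V4 p d g = (\<Sum>s<d. cmod (gauss_period p d g s) ^ 4)"

definition nonzero_triples :: "('a, 'b) ring_scheme \<Rightarrow> ('a \<times> 'a \<times> 'a) set" where
  "nonzero_triples R =
     carrier R \<times> carrier R \<times> carrier R - {(\<zero>\<^bsub>R\<^esub>, \<zero>\<^bsub>R\<^esub>, \<zero>\<^bsub>R\<^esub>)}"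

definition proportional :: "('a, 'b) ring_scheme \<Rightarrow> (('a \<times> 'a \<times> 'a) \<times> ('a \<times> 'a \<times> 'a)) set" where
  "proportional R =
     {((x, y, z), (x', y', z')).
        (x, y, z) \<in> nonzero_triples R \<and> (x', y', z') \<in> nonzero_triples R \<and>
        (\<exists>c \<in> carrier R - {\<zero>\<^bsub>R\<^esub>}.
           x' = c \<otimes>\<^bsub>R\<^esub> x \<and> y' = c \<otimes>\<^bsub>R\<^esub> y \<and> z' = c \<otimes>\<^bsub>R\<^esub> z)}"

definition projective_plane :: "('a, 'b) ring_scheme \<Rightarrow> ('a \<times> 'a \<times> 'a) set set" where
  "projective_plane R = nonzero_triples R // proportional R"

text \<open>The equation is homogeneous, so over a field it holds for all representatives
  of a projective point as soon as it holds for one of them.\<close>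

definition fermat_curve_points ::
    "('a, 'b) ring_scheme \<Rightarrow> nat \<Rightarrow> ('a \<times> 'a \<times> 'a) set set" where
  "fermat_curve_points R n =
     {P \<in> projective_plane R. \<forall>(x, y, z) \<in> P.
        x [^]\<^bsub>R\<^esub> n \<oplus>\<^bsub>R\<^esub> y [^]\<^bsub>R\<^esub> n = z [^]\<^bsub>R\<^esub> n}"

definition M000 :: "nat \<Rightarrow> nat" where
  "M000 p = card (fermat_curve_points (residue_ring (int p)) 3)"

end

(* Put F(a) = sum over x mod p of e_p(a x^3). For a nonzero it depends only on the class of a
   modulo cubes, is real because -1 is a cube, and F(g^s) = 1 + 3 eta_s =: G_s. By orthogonality
   the power sum of order n of all the F(a) is p times the number of zeros of a diagonal cubic form
   in n variables, so the three G_s have power sums 0, 6p and 3p(M - p - 1). Newton's identity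
   for three numbers with sum 0 then gives the fourth power sum and hence V_4. The Hasse bound
   |M - p - 1| <= 2 sqrt p needs no further input: it says that the cubic with the three real roots
   G_s has nonnegative discriminant. *)

theory Submission
  imports Defs
begin

section \<open>Projective points over a field and the cone over the Fermat curve\<close>

context field
begin

lemma nonzero_triples_iff:
  "(x, y, z) \<in> nonzero_triples R \<longleftrightarrow>
    x \<in> carrier R \<and> y \<in> carrier R \<and> z \<in> carrier R \<and> \<not> (x = \<zero> \<and> y = \<zero> \<and> z = \<zero>)"
  by (auto simp: nonzero_triples_def)

lemma scale_nonzero_triples:
  assumes "(x, y, z) \<in> nonzero_triples R" and "c \<in> carrier R - {\<zero>}"
  shows "(c \<otimes> x, c \<otimes> y, c \<otimes> z) \<in> nonzero_triples R"
  using assms by (auto simp: nonzero_triples_iff integral_iff)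

lemma proportional_class:
  assumes "(x, y, z) \<in> nonzero_triples R"
  shows "proportional R `` {(x, y, z)} = (\<lambda>c. (c \<otimes> x, c \<otimes> y, c \<otimes> z)) ` (carrier R - {\<zero>})"
  using assms scale_nonzero_triples by (auto simp: proportional_def)

lemma equiv_proportional: "equiv (nonzero_triples R) (proportional R)"
proof (rule equivI)
  show "proportional R \<subseteq> nonzero_triples R \<times> nonzero_triples R"
    by (auto simp: proportional_def)
  show "refl_on (nonzero_triples R) (proportional R)"
    by (auto simp: refl_on_def proportional_def nonzero_triples_iff intro!: bexI[of _ \<one>])
  show "sym (proportional R)"
  proof (rule symI)
    fix t u assume "(t, u) \<in> proportional R"
    then obtain x y z c where t: "t = (x, y, z)" "(x, y, z) \<in> nonzero_triples R"
      and c: "c \<in> carrier R" "c \<noteq> \<zero>" and u: "u = (c \<otimes> x, c \<otimes> y, c \<otimes> z)"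
      by (cases t; cases u) (auto simp: proportional_def)
    then have "inv c \<in> carrier R - {\<zero>}" "inv c \<otimes> c = \<one>"
      using Units_inv_Units[of c] by (auto simp: field_Units)
    moreover have "(c \<otimes> x, c \<otimes> y, c \<otimes> z) \<in> nonzero_triples R"
      using t c by (auto intro: scale_nonzero_triples)
    ultimately show "(u, t) \<in> proportional R"
      using t c u by (auto simp: proportional_def nonzero_triples_iff m_assoc[symmetric]
          intro!: bexI[of _ "inv c"])
  qed
  show "trans (proportional R)"
  proof (rule transI)
    fix t u v assume "(t, u) \<in> proportional R" "(u, v) \<in> proportional R"
    then obtain x y z c d where t: "t = (x, y, z)" "(x, y, z) \<in> nonzero_triples R"
      and cd: "c \<in> carrier R - {\<zero>}" "d \<in> carrier R - {\<zero>}"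
      and v: "v = (d \<otimes> (c \<otimes> x), d \<otimes> (c \<otimes> y), d \<otimes> (c \<otimes> z))" "v \<in> nonzero_triples R"
      by (cases t; cases u; cases v) (auto simp: proportional_def)
    have "d \<otimes> c \<in> carrier R - {\<zero>}"
      using cd by (auto simp: integral_iff)
    with t cd v show "(t, v) \<in> proportional R"
      by (auto simp: proportional_def nonzero_triples_iff m_assoc intro!: bexI[of _ "d \<otimes> c"])
  qed
qed

text \<open>Scaling acts freely on nonzero triples, because a nonzero coordinate can be cancelled.
  So each class is a bijective image of the nonzero scalars.\<close>

lemma card_projective_point:
  assumes "P \<in> projective_plane R"
  shows "card P = card (carrier R - {\<zero>})"
proof -
  obtain x y z where xyz: "(x, y, z) \<in> nonzero_triples R" and P: "P = proportional R `` {(x, y, z)}"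
    using assms by (auto simp: projective_plane_def elim!: quotientE)
  have "inj_on (\<lambda>c. (c \<otimes> x, c \<otimes> y, c \<otimes> z)) (carrier R - {\<zero>})"
    using xyz by (auto simp: inj_on_def nonzero_triples_iff m_rcancel)
  then show ?thesis
    by (simp add: P proportional_class[OF xyz] card_image)
qed

lemma fermat_equation_scale:
  fixes n :: nat
  assumes "x \<in> carrier R" "y \<in> carrier R" "z \<in> carrier R" "c \<in> carrier R"
    and "x [^] n \<oplus> y [^] n = z [^] n"
  shows "(c \<otimes> x) [^] n \<oplus> (c \<otimes> y) [^] n = (c \<otimes> z) [^] n"
  using assms by (simp add: nat_pow_distrib flip: r_distr)

text \<open>By homogeneity the equation passes from one representative to its whole class, so the
  points of the curve together fill the affine cone without its vertex.\<close>

lemma Union_fermat_curve_points: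
  "\<Union> (fermat_curve_points R n)
    = {(x, y, z). (x, y, z) \<in> nonzero_triples R \<and> x [^] n \<oplus> y [^] n = z [^] n}" (is "?L = ?S")
proof
  show "?L \<subseteq> ?S"
    using in_quotient_imp_subset[OF equiv_proportional]
    by (fastforce simp: fermat_curve_points_def projective_plane_def)
  show "?S \<subseteq> ?L"
  proof clarify
    fix x y z assume xyz: "(x, y, z) \<in> nonzero_triples R" and eq: "x [^] n \<oplus> y [^] n = z [^] n"
    have "proportional R `` {(x, y, z)} \<in> fermat_curve_points R n"
      using xyz eq
      by (auto simp: fermat_curve_points_def projective_plane_def proportional_class[OF xyz]
          nonzero_triples_iff intro!: fermat_equation_scale)
        (auto simp: proportional_class[OF xyz, symmetric] intro!: quotientI xyz)
    moreover have "(x, y, z) \<in> proportional R `` {(x, y, z)}"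
      using equiv_class_self[OF equiv_proportional xyz] .
    ultimately show "(x, y, z) \<in> ?L"
      by blast
  qed
qed

text \<open>The cone without its vertex is the disjoint union of the points on the curve, all of the
  same size. This turns the projective count into a count of affine solutions, which character sums
  can reach.\<close>

lemma card_fermat_cone:
  assumes "finite (carrier R)"
  shows "card {(x, y, z). (x, y, z) \<in> nonzero_triples R \<and> x [^] n \<oplus> y [^] n = z [^] n}
    = card (carrier R - {\<zero>}) * card (fermat_curve_points R n)"
proof -
  have fin: "finite (nonzero_triples R)"
    using assms by (simp add: nonzero_triples_def)
  have sub: "fermat_curve_points R n \<subseteq> projective_plane R"
    by (auto simp: fermat_curve_points_def)
  have "\<Union> (projective_plane R) = nonzero_triples R"
    unfolding projective_plane_def by (rule Union_quotient[OF equiv_proportional])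
  then have "finite (projective_plane R)"
    using fin by (metis finite_UnionD)
  then have "finite (fermat_curve_points R n)"
    using sub by (rule finite_subset[rotated])
  moreover have "finite (\<Union> (fermat_curve_points R n))"
    unfolding Union_fermat_curve_points by (rule finite_subset[OF _ fin]) auto
  moreover have "card P = card (carrier R - {\<zero>})" if "P \<in> fermat_curve_points R n" for P
    using that sub card_projective_point by blast
  moreover have "P \<inter> Q = {}"
    if "P \<in> fermat_curve_points R n" "Q \<in> fermat_curve_points R n" "P \<noteq> Q" for P Q
    using that sub quotient_disj[OF equiv_proportional] by (fastforce simp: projective_plane_def)
  ultimately show ?thesis
    by (simp add: card_partition flip: Union_fermat_curve_points)
qed

end

section \<open>Power sums of three reals with sum zero\<close>

text \<open>If e is the second elementary symmetric function, the square sum is -2 e and the fourth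
  power sum is 2 e^2.\<close>

lemma sum_fourth_powers_of_sum_eq_0:
  fixes a b c :: real
  assumes "a + b + c = 0"
  shows "2 * (a ^ 4 + b ^ 4 + c ^ 4) = (a ^ 2 + b ^ 2 + c ^ 2) ^ 2"
proof -
  have c: "c = - a - b" using assms by simp
  show ?thesis
    unfolding c by (simp add: algebra_simps power2_eq_square power4_eq_xxxx)
qed

text \<open>The difference of the two sides is twice the discriminant of the cubic with roots \<open>a\<close>, \<open>b\<close>, \<open>c\<close>.\<close>

lemma sum_cubes_of_sum_eq_0_le:
  fixes a b c :: real
  assumes "a + b + c = 0"
  shows "6 * (a ^ 3 + b ^ 3 + c ^ 3) ^ 2 \<le> (a ^ 2 + b ^ 2 + c ^ 2) ^ 3"
proof -
  have c: "c = - a - b" using assms by simp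
  have "(a ^ 2 + b ^ 2 + c ^ 2) ^ 3 - 6 * (a ^ 3 + b ^ 3 + c ^ 3) ^ 2
      = 2 * ((a - b) * (b - c) * (c - a)) ^ 2"
    unfolding c by (simp add: algebra_simps power2_eq_square power3_eq_cube)
  then show ?thesis
    by (smt (verit) zero_le_power2)
qed

section \<open>The additive character and its orthogonality\<close>

lemma add_char_0 [simp]: "add_char p 0 = 1"
  by (simp add: add_char_def)

lemma add_char_add: "add_char p (x + y) = add_char p x * add_char p y"
  by (simp add: add_char_def algebra_simps add_divide_distrib flip: exp_add)

lemma add_char_cis: "add_char p x = cis (2 * pi * (of_int x / of_nat p))"
  by (simp add: add_char_def cis_conv_exp mult_ac)

lemma cnj_add_char: "cnj (add_char p x) = add_char p (- x)"
  by (simp add: add_char_cis cis_cnj)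

lemma add_char_mult_left: "add_char p (int a * x) = add_char p x ^ a"
  by (induction a) (simp_all add: algebra_simps add_char_add)

lemma add_char_eq_1_iff:
  assumes "p > 0"
  shows "add_char p x = 1 \<longleftrightarrow> int p dvd x"
proof
  assume "add_char p x = 1"
  \<comment> \<open>The real part alone suffices: a cosine is 1 only at integer multiples of 2
    pi.\<close>
  then have "cos (2 * pi * (of_int x / of_nat p)) = 1"
    by (simp add: add_char_cis complex_eq_iff)
  then obtain n :: int where "2 * pi * (of_int x / of_nat p) = n * 2 * pi"
    by (auto simp: cos_one_2pi_int)
  then have "real_of_int x = of_int (int p * n)"
    using assms by (simp add: field_simps)
  then have "x = int p * n"
    by (simp only: of_int_eq_iff)
  then show "int p dvd x"
    by simp
next
  assume "int p dvd x"
  then obtain n where "x = int p * n" ..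
  with assms show "add_char p x = 1"
    by (simp add: add_char_cis)
qed

lemma add_char_cong:
  assumes "p > 0" and "[x = y] (mod int p)"
  shows "add_char p x = add_char p y"
proof -
  have "add_char p (x - y) = 1"
    using assms by (simp add: add_char_eq_1_iff cong_iff_dvd_diff)
  then show ?thesis
    using add_char_add[of p "x - y" y] by simp
qed

lemma sum_int_residues: "(\<Sum>x\<in>{0..<int p}. f x) = (\<Sum>i<p. f (int i))"
  by (rule sum.reindex_bij_witness[of _ int nat]) auto

text \<open>A geometric sum whose ratio is a \<open>p\<close>-th root of unity; that root is 1
  exactly when \<open>p\<close> divides \<open>x\<close>.\<close>

lemma sum_add_char:
  assumes "p > 0"
  shows "(\<Sum>a\<in>{0..<int p}. add_char p (a * x)) = (if int p dvd x then of_nat p else 0)"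
proof -
  have "(\<Sum>a\<in>{0..<int p}. add_char p (a * x)) = (\<Sum>i<p. add_char p x ^ i)"
    by (simp add: sum_int_residues add_char_mult_left)
  also have "\<dots> = (if int p dvd x then of_nat p else 0)"
  proof (cases "int p dvd x")
    case False
    have "add_char p x ^ p = 1"
      using assms by (simp add: add_char_eq_1_iff flip: add_char_mult_left)
    with False assms show ?thesis
      by (simp add: geometric_sum add_char_eq_1_iff)
  qed (use assms add_char_eq_1_iff[of p x] in simp)
  finally show ?thesis .
qed

text \<open>For each power sum of cubic sums, \<open>T\<close> will be a set of tuples of residues
  and \<open>h\<close> a diagonal cubic form.\<close>

lemma sum_add_char_count:
  assumes "p > 0" and "finite T"
  shows "(\<Sum>a\<in>{0..<int p}. \<Sum>t\<in>T. add_char p (a * h t))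
    = of_nat (p * card {t \<in> T. int p dvd h t})"
  using assms by (subst sum.swap) (simp add: sum_add_char sum.If_cases Int_def)

text \<open>Used with period \<open>k\<close> where a term depends only on the cube of g^i, and with
  period 3 where it depends only on the class of g^i modulo cubes.\<close>

lemma sum_periodic:
  fixes h :: "nat \<Rightarrow> 'a::semiring_1"
  assumes "\<And>i. h (i + m) = h i"
  shows "(\<Sum>i<n * m. h i) = of_nat n * (\<Sum>i<m. h i)"
proof -
  have shift: "h (i + n * m) = h i" for i n
    by (induction n) (simp_all add: assms flip: add.assoc add: add.commute[of m])
  have "(\<Sum>i<n * m. h i) = (\<Sum>j<n. \<Sum>i\<in>{j * m..<j * m + m}. h i)"
    by (simp add: sum.nat_group)
  also have "\<dots> = (\<Sum>j<n. \<Sum>i<m. h i)"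
  proof (rule sum.cong[OF refl])
    fix j
    show "(\<Sum>i\<in>{j * m..<j * m + m}. h i) = (\<Sum>i<m. h i)"
      using sum.shift_bounds_nat_ivl[of h 0 "j * m" m]
      by (simp add: shift lessThan_atLeast0 add.commute)
  qed
  finally show ?thesis
    by simp
qed

section \<open>Cubic exponential sums and Gauss periods\<close>

text \<open>The cubic Gauss sum with coefficient \<open>a\<close>. Unlike the periods it also makes
  sense at \<open>a = 0\<close>, so orthogonality over all residues \<open>a\<close> applies to its
  powers.\<close>

definition cubic_sum :: "nat \<Rightarrow> int \<Rightarrow> complex" where
  "cubic_sum p a = (\<Sum>x\<in>{0..<int p}. add_char p (a * x ^ 3))"

locale cubic_periods =
  fixes p g k :: nat
  assumes prime_p: "prime p" and p_eq: "p = Suc (k * 3)" and primroot: "residue_primroot p g"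
begin

lemma p_gt_0: "p > 0" and p_gt_1: "p > 1" and k_gt_0: "k > 0"
  using prime_gt_1_nat[OF prime_p] p_eq by auto

lemma period_length: "(p - 1) div 3 = k"
  using p_eq by simp

text \<open>The order of a primitive root is the totient of \<open>p\<close>, here
  \<open>k * 3\<close>.\<close>

lemma g_power_cong_iff: "[g ^ i = g ^ j] (mod p) \<longleftrightarrow> [i = j] (mod k * 3)"
proof -
  have "totient p = k * 3"
    using prime_p p_eq by (simp add: totient_prime)
  then show ?thesis
    using primroot by (simp add: residue_primroot_def order_divides_expdiff)
qed

text \<open>The powers of \<open>g\<close> run once through the nonzero residues, so a sum over
  residues becomes the term at 0 plus a sum over exponents.\<close>

lemma sum_residues:
  fixes f :: "int \<Rightarrow> 'a::comm_monoid_add"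
  assumes "\<And>x. f (x mod int p) = f x"
  shows "(\<Sum>x\<in>{0..<int p}. f x) = f 0 + (\<Sum>i<k * 3. f (int (g ^ i)))"
proof -
  have bij: "bij_betw (\<lambda>i. g ^ i mod p) {..<k * 3} {0<..<p}"
    using residue_primroot_is_generator[OF p_gt_1 primroot] prime_p p_eq
    by (simp add: totient_prime totatives_prime)
  have "(\<Sum>x\<in>{0..<int p}. f x) = (\<Sum>i\<in>{..<p}. f (int i))"
    by (rule sum_int_residues)
  also have "{..<p} = insert 0 {0<..<p}"
    using p_gt_0 by auto
  also have "(\<Sum>i\<in>insert 0 {0<..<p}. f (int i)) = f 0 + (\<Sum>i\<in>{0<..<p}. f (int i))"
    by simp
  also have "(\<Sum>i\<in>{0<..<p}. f (int i)) = (\<Sum>i<k * 3. f (int (g ^ i mod p)))"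
    by (rule sum.reindex_bij_betw[OF bij, symmetric])
  also have "\<dots> = (\<Sum>i<k * 3. f (int (g ^ i)))"
    by (simp add: of_nat_mod assms del: of_nat_power)
  finally show ?thesis .
qed

lemma add_char_g_periodic: "add_char p (int (g ^ (i + k * 3))) = add_char p (int (g ^ i))"
  by (rule add_char_cong[OF p_gt_0])
     (simp add: cong_int_iff g_power_cong_iff del: of_nat_power, simp add: cong_def)

lemma add_char_mod_arg:
  "add_char p (a * (x mod int p) ^ 3) = add_char p (a * x ^ 3)"
  by (rule add_char_cong[OF p_gt_0]) (intro cong_mult cong_pow, simp_all add: cong_def)

lemma add_char_mod_coeff:
  "add_char p ((a mod int p) * y) = add_char p (a * y)"
  by (rule add_char_cong[OF p_gt_0]) (intro cong_mult, simp_all add: cong_def)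

lemma cubic_sum_mod: "cubic_sum p (a mod int p) = cubic_sum p a"
  by (simp add: cubic_sum_def add_char_mod_coeff)

lemma cubic_sum_0: "cubic_sum p 0 = of_nat p"
  by (simp add: cubic_sum_def)

text \<open>Substitute -x for x: -1 is a cube.\<close>

lemma cubic_sum_minus: "cubic_sum p (- a) = cubic_sum p a"
proof -
  have "bij_betw (\<lambda>x. (- x) mod int p) {0..<int p} {0..<int p}"
    by (rule bij_betwI[where g = "\<lambda>x. (- x) mod int p"])
       (use p_gt_0 in \<open>auto simp: mod_minus_eq\<close>)
  from sum.reindex_bij_betw[OF this, of "\<lambda>x. add_char p (a * x ^ 3)"]
  show ?thesis
    by (simp add: cubic_sum_def add_char_mod_arg)
qed

lemma cnj_cubic_sum: "cnj (cubic_sum p a) = cubic_sum p a"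
  by (subst cubic_sum_minus[symmetric]) (simp add: cubic_sum_def cnj_add_char)

text \<open>The residue 0 contributes 1. The residue g^i contributes the character at g^(3i+s),
  which has period \<open>k\<close> in i, so the range of \<open>k * 3\<close> exponents runs
  through the Gauss period three times.\<close>

lemma cubic_sum_power: "cubic_sum p (int (g ^ s)) = 1 + 3 * gauss_period p 3 g s"
proof -
  define h where "h i = add_char p (int (g ^ (3 * i + s)))" for i
  have "h (i + k) = h i" for i
    using add_char_g_periodic[of "3 * i + s"] by (simp add: h_def algebra_simps)
  from sum_periodic[of h k 3, OF this] have "(\<Sum>i<k * 3. h i) = 3 * (\<Sum>i<k. h i)"
    by (simp add: mult.commute)
  moreover have "cubic_sum p (int (g ^ s)) = 1 + (\<Sum>i<k * 3. h i)"
    unfolding cubic_sum_def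
    by (subst sum_residues) (simp_all add: add_char_mod_arg h_def power_add power_mult mult_ac
        flip: power_mult)
  ultimately show ?thesis
    unfolding gauss_period_def period_length by (simp add: h_def)
qed

lemma cubic_sum_power_periodic: "cubic_sum p (int (g ^ (s + 3))) = cubic_sum p (int (g ^ s))"
proof -
  define h where "h i = add_char p (int (g ^ (3 * i + s)))" for i
  \<comment> \<open>Replacing \<open>s\<close> by \<open>s + 3\<close> shifts the index by one. The
    term that enters, \<open>h k\<close>, equals the term \<open>h 0\<close> that leaves.\<close>
  have "(\<Sum>i<k. h (Suc i)) = (\<Sum>i<k. h i)"
    using sum.lessThan_Suc[of h k] sum.lessThan_Suc_shift[of h k] add_char_g_periodic[of s]
    by (simp add: h_def algebra_simps)
  then have "gauss_period p 3 g (s + 3) = gauss_period p 3 g s"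
    unfolding gauss_period_def period_length by (simp add: h_def add_ac)
  then show ?thesis
    by (simp only: cubic_sum_power)
qed

section \<open>The three real values \<open>G\<close> and their power sums\<close>

text \<open>Taking \<open>Re\<close> loses nothing, since the sum equals its conjugate; as reals,
  the values are open to the discriminant inequality.\<close>

definition G :: "nat \<Rightarrow> real" where "G s = Re (cubic_sum p (int (g ^ s)))"

lemma of_real_G: "complex_of_real (G s) = cubic_sum p (int (g ^ s))"
  using cnj_cubic_sum[of "int (g ^ s)"] by (simp add: G_def complex_eq_iff)

lemma cmod_gauss_period: "cmod (gauss_period p 3 g s) = \<bar>(G s - 1) / 3\<bar>"
proof -
  have "gauss_period p 3 g s = complex_of_real ((G s - 1) / 3)"
    by (simp add: of_real_G cubic_sum_power del: of_nat_power)
  then show ?thesis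
    by (simp only: norm_of_real)
qed

text \<open>The coefficient 0 gives p^n, and each of the three values \<open>G s\<close> is taken by
  \<open>k\<close> of the nonzero coefficients.\<close>

lemma sum_cubic_sum_power:
  "(\<Sum>a\<in>{0..<int p}. cubic_sum p a ^ n) = of_real (real p ^ n + real k * (\<Sum>s<3. G s ^ n))"
proof -
  have "(\<Sum>a\<in>{0..<int p}. cubic_sum p a ^ n)
      = of_nat p ^ n + (\<Sum>i<k * 3. cubic_sum p (int (g ^ i)) ^ n)"
    by (subst sum_residues) (simp_all add: cubic_sum_mod cubic_sum_0)
  also have "(\<Sum>i<k * 3. cubic_sum p (int (g ^ i)) ^ n)
      = of_nat k * (\<Sum>i<3. cubic_sum p (int (g ^ i)) ^ n)"
    by (rule sum_periodic) (simp only: cubic_sum_power_periodic)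
  finally show ?thesis
    by (simp add: of_real_G del: of_nat_power)
qed

lemma int_p_dvd_cube_iff: "int p dvd x ^ 3 \<longleftrightarrow> int p dvd x"
  using prime_p by (simp add: prime_dvd_power_iff)

text \<open>In one variable, x^3 = 0 has the single solution 0, so the total is \<open>p\<close>,
  which the coefficient 0 already supplies.\<close>

lemma sum_G: "(\<Sum>s<3. G s) = 0"
proof -
  have "(\<Sum>a\<in>{0..<int p}. cubic_sum p a ^ 1)
      = of_nat (p * card {x \<in> {0..<int p}. int p dvd x ^ 3})"
    using sum_add_char_count[OF p_gt_0, of "{0..<int p}" "\<lambda>x. x ^ 3"]
    by (simp add: cubic_sum_def)
  also have "{x \<in> {0..<int p}. int p dvd x ^ 3} = {0}"
    using p_gt_0 by (auto simp: int_p_dvd_cube_iff zdvd_not_zless dest: zdvd_imp_le)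
  finally have "complex_of_real (real p ^ 1 + real k * (\<Sum>s<3. G s ^ 1)) = of_real (real p)"
    unfolding sum_cubic_sum_power by simp
  then show ?thesis
    using k_gt_0 by (simp only: of_real_eq_iff) simp
qed

text \<open>Count pairs with y^3 = x^3: one for y = 0 and three for each of the 3k nonzero y. Hence
  p^2 + k S = p (1 + 9k), and p = 3k + 1 gives S = 6p.\<close>

lemma sum_G_square: "(\<Sum>s<3. G s ^ 2) = 6 * real p"
proof -
  define A where "A = {0..<int p}"
  define D where "D y = card {x \<in> A. int p dvd y ^ 3 - x ^ 3}" for y
  have fin: "finite A" by (simp add: A_def)
  \<comment> \<open>Written as a sum of indicators, the count can be split by
    \<open>sum_residues\<close>.\<close>
  have D_sum: "D y = (\<Sum>x\<in>A. of_bool (int p dvd y ^ 3 - x ^ 3))" for y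
    by (simp add: D_def fin of_bool_def sum.If_cases Int_def)
  have dvd_mod: "int p dvd (y mod int p) ^ 3 - x ^ 3 \<longleftrightarrow> int p dvd y ^ 3 - x ^ 3"
    "int p dvd y ^ 3 - (x mod int p) ^ 3 \<longleftrightarrow> int p dvd y ^ 3 - x ^ 3" for x y
    by (simp_all add: mod_eq_dvd_iff[symmetric] power_mod)
  have D_mod: "D (y mod int p) = D y" for y
    by (simp add: D_def dvd_mod)
  have D_0: "D 0 = 1"
  proof -
    have "{x \<in> A. int p dvd 0 ^ 3 - x ^ 3} = {0}"
      using p_gt_0 by (auto simp: A_def int_p_dvd_cube_iff zdvd_not_zless dest: zdvd_imp_le)
    then show ?thesis by (simp add: D_def)
  qed
  have D_g: "D (int (g ^ j)) = 3" for j
  proof -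
    \<comment> \<open>Equal cubes mean 3i = 3j modulo 3k, that is i = j modulo k.\<close>
    have iff: "int p dvd int (g ^ j) ^ 3 - int (g ^ i) ^ 3 \<longleftrightarrow> i mod k = j mod k" for i
    proof -
      have "int p dvd int (g ^ j) ^ 3 - int (g ^ i) ^ 3 \<longleftrightarrow> [g ^ (j * 3) = g ^ (i * 3)] (mod p)"
        by (simp add: power_mult cong_iff_dvd_diff flip: cong_int_iff)
      then show ?thesis
        unfolding g_power_cong_iff by (auto simp: cong_def simp flip: mult_mod_left)
    qed
    have "coprime p (g ^ j)"
      using primroot by (simp add: residue_primroot_def)
    then have "\<not> int p dvd int (g ^ j)"
      using p_gt_1 coprime_absorb_left[of p "g ^ j"] by (auto simp del: of_nat_power)
    \<comment> \<open>This is the indicator at x = 0, the term that \<open>sum_residues\<close>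
      splits off; it vanishes.\<close>
    then have "\<not> int p dvd int (g ^ j) ^ 3 - 0 ^ 3"
      by (simp add: int_p_dvd_cube_iff del: of_nat_power)
    then have "D (int (g ^ j)) = (\<Sum>i<k * 3. of_bool (i mod k = j mod k))"
      unfolding D_sum A_def by (subst sum_residues) (simp_all add: dvd_mod iff del: of_nat_power)
    also have "\<dots> = 3 * (\<Sum>i<k. of_bool (i mod k = j mod k))"
      using sum_periodic[of "\<lambda>i. of_bool (i mod k = j mod k) :: nat" k 3]
      by (simp add: mult.commute)
    also have "(\<Sum>i<k. of_bool (i mod k = j mod k) :: nat) = (\<Sum>i<k. if i = j mod k then 1 else 0)"
      by (rule sum.cong) auto
    also have "\<dots> = 1"
      using k_gt_0 by simp
    finally show ?thesis by simp
  qed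
  \<comment> \<open>Evenness lets one factor take the coefficient -a, so that the product yields a
    difference of cubes.\<close>
  have "(\<Sum>a\<in>A. cubic_sum p a ^ 2) = (\<Sum>a\<in>A. cubic_sum p a * cubic_sum p (- a))"
    by (simp add: cubic_sum_minus power2_eq_square)
  also have "\<dots> = (\<Sum>a\<in>A. \<Sum>t\<in>A \<times> A. add_char p (a * (fst t ^ 3 - snd t ^ 3)))"
    by (simp add: cubic_sum_def sum_product sum.cartesian_product add_char_add[symmetric]
        case_prod_unfold algebra_simps flip: A_def)
  also have "\<dots> = of_nat (p * card {t \<in> A \<times> A. int p dvd fst t ^ 3 - snd t ^ 3})"
    unfolding A_def by (rule sum_add_char_count[OF p_gt_0]) simp
  also have "{t \<in> A \<times> A. int p dvd fst t ^ 3 - snd t ^ 3}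
      = Sigma A (\<lambda>y. {x \<in> A. int p dvd y ^ 3 - x ^ 3})"
    by auto
  also have "card \<dots> = (\<Sum>y\<in>A. D y)"
    using fin by (simp add: D_def)
  also have "\<dots> = 1 + k * 3 * 3"
    unfolding A_def by (subst sum_residues) (simp_all add: D_0 D_g D_mod del: of_nat_power)
  finally have "complex_of_real (real p ^ 2 + real k * (\<Sum>s<3. G s ^ 2))
      = of_real (real p * (1 + real k * 9))"
    unfolding A_def sum_cubic_sum_power by (simp add: algebra_simps)
  then have "real p ^ 2 + real k * (\<Sum>s<3. G s ^ 2) = real p * (1 + real k * 9)"
    by (simp only: of_real_eq_iff)
  then have "real k * (\<Sum>s<3. G s ^ 2) = real k * (6 * real p)"
    using p_eq by (simp add: power2_eq_square algebra_simps)
  then show ?thesis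
    using k_gt_0 by simp
qed

text \<open>The affine solutions of x^3 + y^3 = z^3 are the origin and 3k representatives of each
  projective point, so p^3 + k S = p (1 + 3k M).\<close>

lemma sum_G_cube: "(\<Sum>s<3. G s ^ 3) = 3 * real p * (real (M000 p) - real p - 1)"
proof -
  interpret residues_prime p "residue_ring (int p)"
    by unfold_locales (rule prime_p)
  let ?R = "residue_ring (int p)"
  define A where "A = {0..<int p}"
  define C where "C = {(x, y, z). (x, y, z) \<in> nonzero_triples ?R \<and>
    x [^]\<^bsub>?R\<^esub> (3::nat) \<oplus>\<^bsub>?R\<^esub> y [^]\<^bsub>?R\<^esub> (3::nat) = z [^]\<^bsub>?R\<^esub> (3::nat)}"
  have carrier: "carrier ?R = A"
    by (auto simp: res_carrier_eq A_def)
  have pow: "x [^]\<^bsub>?R\<^esub> n = x ^ n mod int p" if "x \<in> A" for x and n :: nat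
    using pow_cong[of x n] that by (simp add: A_def)
  have solutions: "{t \<in> A \<times> A \<times> A. int p dvd fst t ^ 3 + fst (snd t) ^ 3 - snd (snd t) ^ 3}
      = insert (0, 0, 0) C"
    using p_gt_0
    by (auto simp: C_def nonzero_triples_def carrier pow res_zero_eq add_cong mod_eq_dvd_iff)
      (auto simp: A_def)
  have "card C = card (A - {0}) * M000 p"
    using card_fermat_cone[OF finite, of 3]
    by (simp add: C_def M000_def carrier res_zero_eq)
  moreover have "card (A - {0}) = k * 3"
    using p_eq p_gt_0 by (simp add: A_def)
  moreover have "(0, 0, 0) \<notin> C"
    by (simp add: C_def nonzero_triples_def res_zero_eq)
  moreover have "finite C"
    by (rule finite_subset[of _ "A \<times> A \<times> A"])
      (auto simp: C_def nonzero_triples_def carrier A_def)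
  ultimately have card_solutions: "card (insert (0, 0, 0) C) = 1 + k * 3 * M000 p"
    by simp
  \<comment> \<open>Evenness again: the factor with -a moves z^3 to the other side of the
    equation.\<close>
  have "(\<Sum>a\<in>A. cubic_sum p a ^ 3)
      = (\<Sum>a\<in>A. cubic_sum p a * (cubic_sum p a * cubic_sum p (- a)))"
    by (simp add: cubic_sum_minus power3_eq_cube mult_ac)
  also have "\<dots> = (\<Sum>a\<in>A. \<Sum>t\<in>A \<times> A \<times> A.
      add_char p (a * (fst t ^ 3 + fst (snd t) ^ 3 - snd (snd t) ^ 3)))"
    by (simp add: cubic_sum_def sum_product sum.cartesian_product case_prod_unfold
        algebra_simps flip: A_def add_char_add)
  also have "\<dots> = of_nat (p * (1 + k * 3 * M000 p))"
    unfolding card_solutions[symmetric] solutions[symmetric] unfolding A_def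
    by (rule sum_add_char_count[OF p_gt_0]) simp
  finally have "complex_of_real (real p ^ 3 + real k * (\<Sum>s<3. G s ^ 3))
      = of_real (real (p * (1 + k * 3 * M000 p)))"
    unfolding A_def sum_cubic_sum_power by simp
  then have eq: "real p ^ 3 + real k * (\<Sum>s<3. G s ^ 3) = real p * (1 + real k * 3 * real (M000 p))"
    by (simp only: of_real_eq_iff) (simp add: algebra_simps)
  have "real p = real k * 3 + 1"
    using p_eq by simp
  \<comment> \<open>This is p^2 - 1 = (p - 1)(p + 1) with p - 1 = 3k, arranged so that
    \<open>k\<close> cancels below.\<close>
  then have "real p ^ 3 = real p * (1 + real k * 3 * (real p + 1))"
    by (simp add: power3_eq_cube algebra_simps)
  with eq have "real k * (\<Sum>s<3. G s ^ 3) = real k * (3 * real p * (real (M000 p) - real p - 1))"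
    by (simp add: algebra_simps)
  then show ?thesis
    using k_gt_0 by simp
qed

section \<open>The fourth moment and the Hasse bound\<close>

text \<open>A Gauss period is (G - 1)/3, so its fourth power expands into power sums of
  \<open>G\<close>. The point count enters only through the cubes, as the fourth powers are fixed by
  the squares.\<close>

lemma V4_eq: "27 * V4 p 3 g = 6 * real p ^ 2 + 12 * real p + 1 - 4 * real p * (real (M000 p) - real p - 1)"
proof -
  have power4: "81 * ((x - 1) / 3) ^ 4 = x ^ 4 - 4 * x ^ 3 + 6 * x ^ 2 - 4 * x + 1" for x :: real
    by (simp add: power_divide) (simp add: power4_eq_xxxx power3_eq_cube power2_eq_square algebra_simps)
  have "2 * (\<Sum>s<3. G s ^ 4) = (6 * real p) ^ 2"
    using sum_fourth_powers_of_sum_eq_0[of "G 0" "G 1" "G 2"] sum_G sum_G_square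
    by (simp add: eval_nat_numeral)
  then have "(\<Sum>s<3. G s ^ 4) = 18 * real p ^ 2"
    by (simp add: power_mult_distrib)
  moreover have "81 * V4 p 3 g = (\<Sum>s<3. 81 * ((G s - 1) / 3) ^ 4)"
    by (simp add: V4_def cmod_gauss_period sum_distrib_left del: abs_divide)
  moreover have "\<dots> = (\<Sum>s<3. G s ^ 4) - 4 * (\<Sum>s<3. G s ^ 3) + 6 * (\<Sum>s<3. G s ^ 2)
      - 4 * (\<Sum>s<3. G s) + 3"
    by (simp only: power4) (simp add: sum.distrib sum_subtractf sum_distrib_left)
  ultimately show ?thesis
    by (simp add: sum_G sum_G_square sum_G_cube algebra_simps)
qed

lemma M000_bound: "\<bar>real (M000 p) - real p - 1\<bar> \<le> 2 * sqrt p"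
proof -
  define c where "c = real (M000 p) - real p - 1"
  have "6 * (3 * real p * c) ^ 2 \<le> (6 * real p) ^ 3"
    using sum_cubes_of_sum_eq_0_le[of "G 0" "G 1" "G 2"] sum_G sum_G_square sum_G_cube
    by (simp add: eval_nat_numeral c_def)
  \<comment> \<open>Here 216 p^3 is written as 54 p^2 times 4p, so that cancelling leaves c^2 at
    most 4p.\<close>
  then have "54 * real p ^ 2 * c ^ 2 \<le> 54 * real p ^ 2 * (4 * real p)"
    by (simp add: power2_eq_square power3_eq_cube algebra_simps)
  then have "c ^ 2 \<le> 4 * real p"
    by (rule mult_left_le_imp_le) (use p_gt_0 in simp)
  then have "\<bar>c\<bar> \<le> sqrt (4 * real p)"
    by (intro real_le_rsqrt) simp
  then show ?thesis
    by (simp add: c_def real_sqrt_mult)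
qed

end

theorem theorem3p1:
  fixes p g :: nat and t0 :: real
  assumes "prime p" and "3 dvd (p - 1)" and "residue_primroot p g"
    and "t0 = (real (M000 p) - 9) / 9"
  shows "V4 p 3 g = 1 / 27 * (10 * real p ^ 2 - 20 * real p + 1) - 4 / 3 * real p * t0
    \<and> \<bar>27 * V4 p 3 g - (6 * real p ^ 2 + 12 * real p + 1)\<bar> \<le> 8 * real p powr (3 / 2)
    \<and> (6 * real p ^ 2 - 8 * real p powr (3 / 2) + 12 * real p + 1) / 27 \<le> V4 p 3 g
    \<and> V4 p 3 g \<le> (6 * real p ^ 2 + 8 * real p powr (3 / 2) + 12 * real p + 1) / 27"
proof -
  obtain k where "p - 1 = k * 3"
    using assms(2) by (metis dvd_div_mult_self)
  then interpret cubic_periods p g k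
    using assms prime_gt_0_nat[OF assms(1)] by unfold_locales auto
  define c where "c = real (M000 p) - real p - 1"
  have V4: "27 * V4 p 3 g = 6 * real p ^ 2 + 12 * real p + 1 - 4 * real p * c"
    unfolding c_def by (rule V4_eq)
  have "real p powr (3 / 2) = real p powr (1 + 1 / 2)"
    by simp
  also have "\<dots> = real p * sqrt p"
    using p_gt_0 by (simp only: powr_add powr_half_sqrt of_nat_0_le_iff) simp
  finally have powr: "real p powr (3 / 2) = real p * sqrt p" .
  have "4 * real p * \<bar>c\<bar> \<le> 4 * real p * (2 * sqrt p)"
    unfolding c_def by (intro mult_left_mono M000_bound) simp
  then have bound: "\<bar>27 * V4 p 3 g - (6 * real p ^ 2 + 12 * real p + 1)\<bar> \<le> 8 * real p powr (3 / 2)"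
    by (simp add: V4 powr abs_mult)
  \<comment> \<open>Since M = 9 t0 + 9, the error term is c = 9 t0 + 8 - p; the part 8 - p turns
    6p^2 + 12p into 10p^2 - 20p.\<close>
  moreover have "V4 p 3 g = 1 / 27 * (10 * real p ^ 2 - 20 * real p + 1) - 4 / 3 * real p * t0"
    using V4 by (simp add: assms(4) c_def power2_eq_square field_simps)
  ultimately show ?thesis
    by (simp add: abs_le_iff field_simps)
qed

end
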